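(* Let $p$ be an odd prime, $A=\binom{p+1}{2}$, $\varrho=\log_pA$, and let $\varphi:[0,1]\to\mathbb{R}$ be defined by $$\varphi\Big(\sum_{j\ge1}b_jp^{-j}\Big)=\frac12\sum_{j\ge1}\frac{b_j}{A^j}\prod_{1\le i\le j}(b_i+1),\qquad b_j\in\{0,1,\dots,p-1\}$$ (independent of the choice of base-$p$ expansion). Let $G(s)=s^{-\varrho}\varphi(s)$ for $s\in(0,1]$. Fix integers $M\ge1$ and $m$ with $1\le m<p^M$, write $m=a_1p^{M-1}+\dots+a_M$ with digits $a_i\in\{0,\dots,p-1\}$, and set $\mu=(m+\frac12)/p^M$, $\tau_M=\prod_{i=1}^M(1+a_i)/A^M$. For $k\ge0$, $t\in[0,1]$ let $$\theta_k(t)=\frac{m}{p^M}+\sum_{M<j\le M+k}\frac{p-1}{2p^j}+\frac{t}{p^{M+k}},\qquad I_{M+k}=\Big[\mu-\frac{1}{2p^{M+k}},\,\mu+\frac{1}{2p^{M+k}}\Big],$$ and define $$\mathcal{Q}_\mu(t)=\tau_M\mu\Big(\varphi(t)-\varphi\big(\tfrac12\big)\Big)-\frac{\varrho\,\varphi(\mu)}{p^M}\Big(t-\tfrac12\Big),\qquad E_{\mu,k}(t)=\frac{\tau_M\varrho}{p^{M+k}}\Big(\varphi(t)-\varphi\big(\tfrac12\big)\Big)\Big(t-\tfrac12\Big).$$ Then, uniformly for $t\in[0,1]$, as $k\to\infty$, $$p^k\big(G(\theta_k(t))-G(\mu)\big)=\mu^{-\varrho-1}\big(\mathcal{Q}_\mu(t)+O(p^{-k})\big).$$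 Furthermore, if for some $k\ge0$ we have $\mathcal{Q}_\mu(t)\ge E_{\mu,k}(t)$ for all $t\in[0,\frac12-\frac1{2p}]\cup[\frac12+\frac1{2p},1]$, then $G(\mu)$ is the minimum of $G$ on $I_{M+k}$, and this minimum is attained only at $\mu$.
   Context: The implied constant in $O(p^{-k})$ depends on $p$, $M$ and $m$ only. *)

theory Defs
  imports "HOL-Analysis.Analysis"
begin

definition binA :: "nat \<Rightarrow> real" where
  "binA p = real ((p + 1) choose 2)"

definition rho :: "nat \<Rightarrow> real" where
  "rho p = log (real p) (binA p)"

text \<open>Digit sequences are indexed from 1; the value at index 0 is irrelevant.\<close>

definition base_expansion :: "nat \<Rightarrow> (nat \<Rightarrow> nat) \<Rightarrow> real \<Rightarrow> bool" where
  "base_expansion p b x \<longleftrightarrow>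
     (\<forall>j\<ge>1. b j \<le> p - 1) \<and> (\<lambda>j. real (b (Suc j)) / real p ^ Suc j) sums x"

definition phi_digits :: "nat \<Rightarrow> (nat \<Rightarrow> nat) \<Rightarrow> real" where
  "phi_digits p b =
     1 / 2 * (\<Sum>j. real (b (Suc j)) / binA p ^ Suc j * (\<Prod>i = 1..Suc j. real (b i) + 1))"

text \<open>The description operator is justified by \<open>base_expansion_exists\<close> and
  \<open>phi_base_expansion\<close> below. Outside [0,1] there is no expansion and the value is unspecified.\<close>

definition phi :: "nat \<Rightarrow> real \<Rightarrow> real" where
  "phi p x = (THE y. \<exists>b. base_expansion p b x \<and> y = phi_digits p b)"

definition G :: "nat \<Rightarrow> real \<Rightarrow> real" where
  "G p s = s powr (- rho p) * phi p s"

definition mu :: "nat \<Rightarrow> nat \<Rightarrow> nat \<Rightarrow> real" where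
  "mu p M m = (real m + 1 / 2) / real p ^ M"

definition tau :: "nat \<Rightarrow> nat \<Rightarrow> (nat \<Rightarrow> nat) \<Rightarrow> real" where
  "tau p M a = (\<Prod>i = 1..M. 1 + real (a i)) / binA p ^ M"

definition theta :: "nat \<Rightarrow> nat \<Rightarrow> nat \<Rightarrow> nat \<Rightarrow> real \<Rightarrow> real" where
  "theta p M m k t =
     real m / real p ^ M + (\<Sum>j\<in>{M<..M + k}. (real p - 1) / (2 * real p ^ j)) + t / real p ^ (M + k)"

definition Iv :: "nat \<Rightarrow> nat \<Rightarrow> nat \<Rightarrow> nat \<Rightarrow> real set" where
  "Iv p M m k =
     {mu p M m - 1 / (2 * real p ^ (M + k)) .. mu p M m + 1 / (2 * real p ^ (M + k))}"

definition Qmu :: "nat \<Rightarrow> nat \<Rightarrow> nat \<Rightarrow> (nat \<Rightarrow> nat) \<Rightarrow> real \<Rightarrow> real" where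
  "Qmu p M m a t =
     tau p M a * mu p M m * (phi p t - phi p (1 / 2))
     - rho p * phi p (mu p M m) / real p ^ M * (t - 1 / 2)"

definition Emu :: "nat \<Rightarrow> nat \<Rightarrow> (nat \<Rightarrow> nat) \<Rightarrow> nat \<Rightarrow> real \<Rightarrow> real" where
  "Emu p M a k t =
     tau p M a * rho p / real p ^ (M + k) * (phi p t - phi p (1 / 2)) * (t - 1 / 2)"


lemma binA_eq: "binA p = real p * (real p + 1) / 2"
proof -
  have "even ((p + 1) * p)" by auto
  then have "real ((p + 1) * p div 2) = real ((p + 1) * p) / 2"
    by (metis of_nat_numeral real_of_nat_div)
  then show ?thesis
    by (simp add: binA_def choose_two algebra_simps)
qed

lemma binA_pos: "p \<ge> 2 \<Longrightarrow> binA p > 0"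
  by (simp add: binA_eq)

lemma p_over_binA: "p \<ge> 2 \<Longrightarrow> real p / binA p = 2 / (real p + 1)"
proof -
  assume "p \<ge> 2"
  then have "real p > 0" "real p + 1 > 0" by auto
  then show ?thesis unfolding binA_eq by (simp add: divide_simps)
qed

definition phi_term :: "nat \<Rightarrow> (nat \<Rightarrow> nat) \<Rightarrow> nat \<Rightarrow> real" where
  "phi_term p b j = real (b (Suc j)) / binA p ^ Suc j * (\<Prod>i = 1..Suc j. real (b i) + 1)"

lemma phi_digits_eq: "phi_digits p b = 1 / 2 * (\<Sum>j. phi_term p b j)"
  by (simp add: phi_digits_def phi_term_def)

lemma phi_term_nonneg: "phi_term p b j \<ge> 0"
  unfolding phi_term_def binA_def by (intro mult_nonneg_nonneg prod_nonneg) auto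

lemma phi_term_le:
  assumes p: "p \<ge> 2" and b: "\<forall>j\<ge>1. b j \<le> p - 1"
  shows "phi_term p b j \<le> (real p - 1) * (2 / (real p + 1)) ^ Suc j"
proof -
  have le: "real (b i) \<le> real p - 1" if "i \<ge> 1" for i
    using b[rule_format, OF that] p by linarith
  have "(\<Prod>i = 1..Suc j. real (b i) + 1) \<le> (\<Prod>i = 1..Suc j. real p)"
    by (rule prod_mono) (use le in fastforce)
  then have "(\<Prod>i = 1..Suc j. real (b i) + 1) \<le> real p ^ Suc j"
    by simp
  then have "phi_term p b j \<le> (real p - 1) / binA p ^ Suc j * real p ^ Suc j"
    unfolding phi_term_def using le[of "Suc j"] binA_pos[OF p] p
    by (intro mult_mono divide_right_mono prod_nonneg) auto
  also have "\<dots> = (real p - 1) * (real p / binA p) ^ Suc j"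
    by (simp add: power_divide)
  finally show ?thesis by (simp only: p_over_binA[OF p])
qed

lemma phi_geometric_sums:
  assumes p: "p \<ge> 2"
  shows "(\<lambda>j. (real p - 1) * (2 / (real p + 1)) ^ Suc j) sums 2"
proof -
  have "(\<lambda>j. (2 / (real p + 1)) ^ j) sums (1 / (1 - 2 / (real p + 1)))"
    by (rule geometric_sums) (use p in auto)
  from sums_mult[OF this, of "(real p - 1) * (2 / (real p + 1))"]
  have "(\<lambda>j. (real p - 1) * (2 / (real p + 1)) ^ Suc j) sums
      ((real p - 1) * (2 / (real p + 1)) * (1 / (1 - 2 / (real p + 1))))"
    by (simp only: mult.assoc power_Suc)
  also have "(real p - 1) * (2 / (real p + 1)) * (1 / (1 - 2 / (real p + 1))) = 2"
  proof -
    have "1 - 2 / (real p + 1) = (real p - 1) / (real p + 1)"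
      by (simp add: field_simps)
    moreover have "real p - 1 > 0" "real p + 1 > 0" using p by auto
    ultimately show ?thesis by (simp add: divide_simps)
  qed
  finally show ?thesis .
qed

lemma phi_term_summable:
  assumes p: "p \<ge> 2" and b: "\<forall>j\<ge>1. b j \<le> p - 1"
  shows "summable (phi_term p b)"
  by (rule summable_comparison_test'[OF sums_summable[OF phi_geometric_sums[OF p]], of 0])
     (use phi_term_le[OF p b] phi_term_nonneg in auto)

lemma phi_digits_bounds:
  assumes p: "p \<ge> 2" and b: "\<forall>j\<ge>1. b j \<le> p - 1"
  shows "0 \<le> phi_digits p b" "phi_digits p b \<le> 1"
proof -
  show "0 \<le> phi_digits p b"
    unfolding phi_digits_eq
    by (intro mult_nonneg_nonneg suminf_nonneg phi_term_summable assms phi_term_nonneg) auto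
  have "suminf (phi_term p b) \<le> 2"
    using suminf_le[OF phi_term_le[OF p b] phi_term_summable[OF p b]
        sums_summable[OF phi_geometric_sums[OF p]]]
      sums_unique[OF phi_geometric_sums[OF p]] by simp
  then show "phi_digits p b \<le> 1" by (simp add: phi_digits_eq)
qed

lemma phi_digits_step:
  assumes p: "p \<ge> 2" and b: "\<forall>j\<ge>1. b j \<le> p - 1"
  shows "phi_digits p b =
    (real (b 1) + 1) / binA p * (real (b 1) / 2 + phi_digits p (\<lambda>j. b (Suc j)))"
proof -
  let ?c = "\<lambda>j. b (Suc j)"
  have c: "\<forall>j\<ge>1. ?c j \<le> p - 1" using b by simp
  have eq: "phi_term p b (Suc j) = (real (b 1) + 1) / binA p * phi_term p ?c j" for j
  proof -
    have "(\<Prod>i = 1..Suc (Suc j). real (b i) + 1) =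
        (real (b 1) + 1) * (\<Prod>i = Suc 1..Suc (Suc j). real (b i) + 1)"
      by (rule prod.atLeast_Suc_atMost) simp
    also have "(\<Prod>i = Suc 1..Suc (Suc j). real (b i) + 1) = (\<Prod>i = 1..Suc j. real (b (Suc i)) + 1)"
      by (rule prod.shift_bounds_cl_Suc_ivl)
    finally show ?thesis by (simp add: phi_term_def)
  qed
  have "suminf (phi_term p b) = (\<Sum>j. phi_term p b (Suc j)) + phi_term p b 0"
    using suminf_split_head[OF phi_term_summable[OF p b]] by simp
  also have "(\<Sum>j. phi_term p b (Suc j)) = (real (b 1) + 1) / binA p * suminf (phi_term p ?c)"
    unfolding eq by (rule suminf_mult[OF phi_term_summable[OF p c]])
  also have "phi_term p b 0 = (real (b 1) + 1) / binA p * real (b 1)"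
    by (simp add: phi_term_def)
  finally show ?thesis
    unfolding phi_digits_eq by (simp add: algebra_simps add_divide_distrib)
qed

lemma base_geometric_sums:
  assumes p: "p \<ge> 2"
  shows "(\<lambda>j. (real p - 1) / real p ^ Suc j) sums 1"
proof -
  have "(\<lambda>j. (1 / real p) ^ j) sums (1 / (1 - 1 / real p))"
    by (rule geometric_sums) (use p in auto)
  from sums_mult[OF this, of "(real p - 1) / real p"]
  have "(\<lambda>j. (real p - 1) / real p ^ Suc j) sums
      ((real p - 1) / real p * (1 / (1 - 1 / real p)))"
    by (simp add: power_divide)
  also have "(real p - 1) / real p * (1 / (1 - 1 / real p)) = 1"
    using p by (simp add: field_simps)
  finally show ?thesis .
qed

lemma base_expansion_tail:
  assumes p: "p \<ge> 2" and e: "base_expansion p b x"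
  shows "base_expansion p (\<lambda>j. b (Suc j)) (real p * x - real (b 1))"
proof -
  have "(\<lambda>j. real (b (Suc (Suc j))) / real p ^ Suc (Suc j)) sums (x - real (b 1) / real p)"
    using e unfolding base_expansion_def by (subst sums_Suc_iff) simp
  from sums_mult[OF this, of "real p"]
  have "(\<lambda>j. real (b (Suc (Suc j))) / real p ^ Suc j) sums (real p * x - real (b 1))"
    using p by (simp add: right_diff_distrib)
  then show ?thesis
    using e by (simp add: base_expansion_def)
qed

lemma base_expansion_range:
  assumes p: "p \<ge> 2" and e: "base_expansion p b x"
  shows "0 \<le> x" "x \<le> 1"
proof -
  have s: "(\<lambda>j. real (b (Suc j)) / real p ^ Suc j) sums x"
    and b: "\<forall>j\<ge>1. b j \<le> p - 1"
    using e by (auto simp: base_expansion_def)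
  show "0 \<le> x" by (rule sums_le[OF _ sums_zero s]) auto
  have "real (b (Suc j)) \<le> real p - 1" for j
    using b[rule_format, of "Suc j"] p by linarith
  then show "x \<le> 1"
    by (intro sums_le[OF _ s base_geometric_sums[OF p]] divide_right_mono) auto
qed

lemma phi_digits_zero:
  assumes p: "p \<ge> 2" and e: "base_expansion p b 0"
  shows "phi_digits p b = 0"
proof -
  have s: "(\<lambda>j. real (b (Suc j)) / real p ^ Suc j) sums 0"
    using e by (simp add: base_expansion_def)
  have "\<forall>j. real (b (Suc j)) / real p ^ Suc j = 0"
    using suminf_eq_zero_iff[OF sums_summable[OF s]] sums_unique[OF s] by simp
  then have "phi_term p b j = 0" for j
    using p by (auto simp: phi_term_def)
  then show ?thesis by (simp add: phi_digits_eq)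
qed

lemma phi_digits_one:
  assumes p: "p \<ge> 2" and e: "base_expansion p b 1"
  shows "phi_digits p b = 1"
proof -
  have s: "(\<lambda>j. real (b (Suc j)) / real p ^ Suc j) sums 1"
    and b: "\<forall>j\<ge>1. b j \<le> p - 1"
    using e by (auto simp: base_expansion_def)
  have nn: "real (b (Suc j)) \<le> real p - 1" for j
    using b[rule_format, of "Suc j"] p by linarith
  have d: "(\<lambda>j. (real p - 1) / real p ^ Suc j - real (b (Suc j)) / real p ^ Suc j) sums (1 - 1)"
    by (rule sums_diff[OF base_geometric_sums[OF p] s])
  have "(real p - 1) / real p ^ Suc j - real (b (Suc j)) / real p ^ Suc j \<ge> 0" for j
    using nn[of j] by (simp add: diff_divide_distrib[symmetric])
  then have "\<forall>j. (real p - 1) / real p ^ Suc j - real (b (Suc j)) / real p ^ Suc j = 0"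
    using suminf_eq_zero_iff[OF sums_summable[OF d]] sums_unique[OF d] by simp
  then have beq: "real (b (Suc j)) = real p - 1" for j
    using p by (simp add: diff_divide_distrib[symmetric])
  have "(\<Prod>i = 1..Suc j. real (b i) + 1) = (\<Prod>i = 1..Suc j. real p)" for j
  proof (rule prod.cong[OF refl])
    fix i assume "i \<in> {1..Suc j}"
    then show "real (b i) + 1 = real p" using beq[of "i - 1"] by simp
  qed
  then have "(\<Prod>i = 1..Suc j. real (b i) + 1) = real p ^ Suc j" for j
    by (simp only: prod_constant card_atLeastAtMost diff_Suc_1)
  then have "phi_term p b j = (real p - 1) * (real p / binA p) ^ Suc j" for j
    by (simp add: phi_term_def beq power_divide)
  then have "phi_term p b = (\<lambda>j. (real p - 1) * (2 / (real p + 1)) ^ Suc j)"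
    by (simp only: p_over_binA[OF p] fun_eq_iff) simp
  then show ?thesis
    using sums_unique[OF phi_geometric_sums[OF p]] by (simp add: phi_digits_eq)
qed

lemma phi_digits_carry:
  assumes p: "p \<ge> 2" and e: "base_expansion p b x" and f: "base_expansion p c x"
    and less: "b 1 < c 1"
  shows "phi_digits p b = phi_digits p c"
proof -
  let ?y = "real p * x - real (b 1)" and ?z = "real p * x - real (c 1)"
  note te = base_expansion_tail[OF p e] and tf = base_expansion_tail[OF p f]
  have y: "?y \<le> 1" and z: "?z \<ge> 0"
    using base_expansion_range[OF p te] base_expansion_range[OF p tf] by auto
  have c1: "c 1 = b 1 + 1" using y z less by linarith
  have "?y = 1" "?z = 0" using y z c1 by auto
  then have tails: "phi_digits p (\<lambda>j. b (Suc j)) = 1" "phi_digits p (\<lambda>j. c (Suc j)) = 0"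
    using phi_digits_one[OF p, of "\<lambda>j. b (Suc j)"] phi_digits_zero[OF p, of "\<lambda>j. c (Suc j)"] te tf
    by simp_all
  have B: "\<forall>j\<ge>1. b j \<le> p - 1" "\<forall>j\<ge>1. c j \<le> p - 1"
    using e f unfolding base_expansion_def by blast+
  show ?thesis
    unfolding phi_digits_step[OF p B(1)] phi_digits_step[OF p B(2)] tails c1
    by (simp add: field_simps)
qed

lemma phi_digits_unique:
  assumes p: "p \<ge> 2" and e: "base_expansion p b x" and f: "base_expansion p c x"
  shows "phi_digits p b = phi_digits p c"
proof -
  define r where "r = 2 / (real p + 1)"
  have r: "0 \<le> r" "r < 1" using p by (auto simp: r_def)
  have bound: "\<bar>phi_digits p b - phi_digits p c\<bar> \<le> r ^ n"
    if "base_expansion p b x" "base_expansion p c x" for n b c x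
    using that
  proof (induction n arbitrary: b c x)
    case 0
    then have "\<forall>j\<ge>1. b j \<le> p - 1" "\<forall>j\<ge>1. c j \<le> p - 1"
      by (auto simp: base_expansion_def)
    then show ?case
      using phi_digits_bounds[OF p, of b] phi_digits_bounds[OF p, of c] by auto
  next
    case (Suc n)
    then have B: "\<forall>j\<ge>1. b j \<le> p - 1" "\<forall>j\<ge>1. c j \<le> p - 1"
      by (auto simp: base_expansion_def)
    consider "b 1 < c 1" | "c 1 < b 1" | "b 1 = c 1" by linarith
    then show ?case
    proof cases
      case 1
      then show ?thesis using phi_digits_carry[OF p Suc.prems] r by simp
    next
      case 2
      then show ?thesis using phi_digits_carry[OF p Suc.prems(2,1)] r by simp
    next
      case 3
      let ?d = "\<bar>phi_digits p (\<lambda>j. b (Suc j)) - phi_digits p (\<lambda>j. c (Suc j))\<bar>"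
      let ?q = "(real (b 1) + 1) / binA p"
      have IH: "?d \<le> r ^ n"
        using Suc.IH base_expansion_tail[OF p Suc.prems(1)] base_expansion_tail[OF p Suc.prems(2)] 3
        by simp
      have "real (b 1) + 1 \<le> real p" using B(1)[rule_format, of 1] p by linarith
      then have "?q \<le> real p / binA p"
        using binA_pos[OF p] by (intro divide_right_mono) auto
      then have q: "0 \<le> ?q" "?q \<le> r"
        using binA_pos[OF p] by (auto simp: r_def p_over_binA[OF p])
      have "phi_digits p b - phi_digits p c =
          ?q * (phi_digits p (\<lambda>j. b (Suc j)) - phi_digits p (\<lambda>j. c (Suc j)))"
        unfolding phi_digits_step[OF p B(1)] phi_digits_step[OF p B(2)] 3
        by (simp add: algebra_simps)
      then have "\<bar>phi_digits p b - phi_digits p c\<bar> = ?q * ?d"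
        using q by (simp only: abs_mult abs_of_nonneg)
      also have "\<dots> \<le> r * r ^ n" by (intro mult_mono q IH) (use r in auto)
      finally show ?thesis by simp
    qed
  qed
  have "(\<lambda>n. r ^ n) \<longlonglongrightarrow> 0" using r by (intro LIMSEQ_power_zero) auto
  then have "\<bar>phi_digits p b - phi_digits p c\<bar> \<le> 0"
    by (rule LIMSEQ_le_const) (use bound[OF e f] in auto)
  then show ?thesis by simp
qed

theorem phi_base_expansion:
  assumes "p \<ge> 2" and "base_expansion p b x"
  shows "phi p x = phi_digits p b"
  unfolding phi_def using assms phi_digits_unique[OF assms(1)]
  by (intro the_equality) blast+

theorem base_expansion_exists:
  assumes p: "p \<ge> 2" and x: "0 \<le> x" "x \<le> 1"
  shows "\<exists>b. base_expansion p b x"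
proof (cases "x = 1")
  case True
  have "base_expansion p (\<lambda>_. p - 1) 1"
    using base_geometric_sums[OF p] p by (simp add: base_expansion_def of_nat_diff)
  then show ?thesis using True by blast
next
  case False
  define u where "u j = \<lfloor>x * real p ^ j\<rfloor>" for j
  define d where "d j = u j - int p * u (j - 1)" for j
  have d: "0 \<le> d (Suc j)" "d (Suc j) < int p" for j
  proof -
    define y where "y = x * real p ^ j"
    have uj: "u j = \<lfloor>y\<rfloor>" "u (Suc j) = \<lfloor>real p * y\<rfloor>"
      by (auto simp: u_def y_def ac_simps)
    have "real p * of_int \<lfloor>y\<rfloor> \<le> real p * y" by (intro mult_left_mono) auto
    then have "int p * \<lfloor>y\<rfloor> \<le> \<lfloor>real p * y\<rfloor>" by (simp add: le_floor_iff)
    then show "0 \<le> d (Suc j)" by (simp add: d_def uj)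
    have "real p * y < real p * (of_int \<lfloor>y\<rfloor> + 1)"
      using p by (intro mult_strict_left_mono) auto
    then have "real p * y < of_int (int p * \<lfloor>y\<rfloor> + int p)" by (simp add: algebra_simps)
    then have "\<lfloor>real p * y\<rfloor> < int p * \<lfloor>y\<rfloor> + int p" by (simp only: floor_less_iff)
    then show "d (Suc j) < int p" by (simp add: d_def uj)
  qed
  define b where "b j = nat (d j)" for j
  have u0: "u 0 = 0" using x False by (simp add: u_def floor_eq_iff)
  have part: "(\<Sum>j<n. real (b (Suc j)) / real p ^ Suc j) = of_int (u n) / real p ^ n" for n
  proof (induction n)
    case 0 then show ?case by (simp add: u0)
  next
    case (Suc n)
    have "real (b (Suc n)) = of_int (u (Suc n)) - real p * of_int (u n)"
      using d(1)[of n] by (simp add: b_def d_def)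
    then show ?case using Suc p by (simp add: field_simps)
  qed
  have "(\<lambda>n. of_int (u n) / real p ^ n) \<longlonglongrightarrow> x"
  proof (rule real_tendsto_sandwich)
    have lb: "x - (1 / real p) ^ n \<le> of_int (u n) / real p ^ n" for n
    proof -
      have "x * real p ^ n - 1 \<le> of_int (u n)" unfolding u_def by linarith
      then have "(x * real p ^ n - 1) / real p ^ n \<le> of_int (u n) / real p ^ n"
        by (rule divide_right_mono) auto
      then show ?thesis using p by (simp add: diff_divide_distrib power_divide)
    qed
    show "\<forall>\<^sub>F n in sequentially. x - (1 / real p) ^ n \<le> of_int (u n) / real p ^ n"
      using lb by simp
    have ub: "of_int (u n) / real p ^ n \<le> x" for n
      using p by (simp add: u_def divide_le_eq)
    show "\<forall>\<^sub>F n in sequentially. of_int (u n) / real p ^ n \<le> x" using ub by simp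
    have "(\<lambda>n. x - (1 / real p) ^ n) \<longlonglongrightarrow> x - 0"
      by (intro tendsto_intros LIMSEQ_power_zero) (use p in auto)
    then show "(\<lambda>n. x - (1 / real p) ^ n) \<longlonglongrightarrow> x" by simp
  qed auto
  then have "(\<lambda>j. real (b (Suc j)) / real p ^ Suc j) sums x"
    unfolding sums_def part .
  moreover have "b j \<le> p - 1" if "j \<ge> 1" for j
    using d(2)[of "j - 1"] that p by (simp add: b_def)
  ultimately show ?thesis unfolding base_expansion_def by blast
qed

end

theory Submission
  imports Defs
begin

text \<open>
  Prepending a digit \<open>d\<close> acts on \<open>\<phi>\<close> by an affine map of slope \<open>(d + 1) / A\<close>, and for the middle
  digit \<open>d = (p - 1) / 2\<close> this slope is exactly \<open>1 / p\<close>. Since \<open>\<theta>\<^sub>k(t) = \<mu> + (t - 1/2) / p\<^bsup>M+k\<^esup>\<close>, this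
  gives \<open>\<phi>(\<theta>\<^sub>k(t)) = \<phi>(\<mu>) + \<tau>\<^sub>M p\<^bsup>-k\<^esup> (\<phi>(t) - \<phi>(1/2))\<close> without error term. The expansion of \<open>G\<close> follows by
  inserting \<open>(1 + x)\<^bsup>-\<rho>\<^esup> = 1 - \<rho>x + O(x\<^sup>2)\<close> with \<open>x = (\<theta>\<^sub>k(t) - \<mu>) / \<mu>\<close>. For the minimum, the strict
  Bernoulli inequality \<open>(1 + x)\<^bsup>-\<rho>\<^esup> > 1 - \<rho>x\<close> bounds \<open>p\<^sup>k \<mu>\<^bsup>\<rho>+1\<^esup> (G(\<theta>\<^sub>k(t)) - G(\<mu>))\<close> strictly from below by
  \<open>Q - E\<^sub>k\<close>. As \<open>\<phi>\<close> is increasing, \<open>E\<^sub>k \<ge> 0\<close>, so the hypothesis passes from \<open>k\<close> to every larger index,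
  and the outer parts of the intervals at all levels \<open>\<ge> k\<close> exhaust \<open>I\<^bsub>M+k\<^esub>\<close> without \<open>\<mu>\<close>.
\<close>

section \<open>Negative powers near 1\<close>

text \<open>From ln (1 + x) < x and exp y \<ge> 1 + y; the strictness at x \<noteq> 0 later makes
  the minimum unique.\<close>

lemma powr_minus_gt_linear:
  fixes x q :: real
  assumes "x > -1" "x \<noteq> 0" "q > 0"
  shows "(1 + x) powr (- q) > 1 - q * x"
proof -
  have "ln (1 + x) < x"
    using ln_add_one_self_le_self2[of x] ln_eq_minus_one[of "1 + x"] assms by fastforce
  then have "1 - q * x < 1 + (- q * ln (1 + x))" using assms by simp
  also have "\<dots> \<le> exp (- q * ln (1 + x))" by (rule exp_ge_add_one_self)
  finally show ?thesis using assms by (simp add: powr_def)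
qed

lemma powr_minus_ge_linear:
  fixes x q :: real
  assumes "x > -1" "q > 0"
  shows "(1 + x) powr (- q) \<ge> 1 - q * x"
  using powr_minus_gt_linear[of x q] assms by (cases "x = 0") auto

text \<open>Convexity: the tangent at x, evaluated at 0, lies below the value 1. It is Bernoulli's
  inequality at -x / (1 + x), because 1 - x / (1 + x) = 1 / (1 + x).\<close>

lemma powr_minus_le_tangent:
  fixes x q :: real
  assumes x: "x > -1" and q: "q > 0"
  shows "(1 + x) powr (- q) \<le> 1 - q * x * (1 + x) powr (- q - 1)"
proof -
  let ?y = "- x / (1 + x)"
  have y: "1 + ?y = inverse (1 + x)" using x by (simp add: field_simps)
  then have "1 + ?y > 0" using x by simp
  then have "?y > -1" by linarith
  from powr_minus_ge_linear[OF this q]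
  have "1 + q * x / (1 + x) \<le> (1 + x) powr q"
    unfolding y using x by (simp add: powr_minus inverse_powr)
  then have "(1 + q * x / (1 + x)) * (1 + x) powr (- q) \<le> (1 + x) powr q * (1 + x) powr (- q)"
    by (rule mult_right_mono) simp
  moreover have "(1 + x) powr q * (1 + x) powr (- q) = 1"
    using x by (simp add: powr_add[symmetric])
  moreover have "(1 + x) powr (- q - 1) = (1 + x) powr (- q) / (1 + x)"
    using x by (simp add: powr_diff)
  ultimately show ?thesis by (simp add: algebra_simps)
qed

text \<open>Quadratic error without derivatives: the tangent bound leaves q x (1 - (1 + x)^(-q-1)),
  and first-order bounds with exponent q + 1 supply the second factor x.\<close>

lemma powr_minus_linear_error:
  fixes x q :: real
  assumes x: "\<bar>x\<bar> \<le> 1/3" and q: "q > 0"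
  shows "\<bar>(1 + x) powr (- q) - 1 + q * x\<bar> \<le> q * (q + 1) * (2/3) powr (- q - 2) * x\<^sup>2"
proof -
  \<comment> \<open>The largest value of (1 + x)^(-q-2) for |x| \<le> 1/3, needed when x < 0;
    \<open>K \<ge> 1\<close> lets it serve for x \<ge> 0 as well.\<close>
  define K :: real where "K = (2/3) powr (- q - 2)"
  have K: "K \<ge> 1"
    unfolding K_def using powr_mono2'[of "- q - 2" "2/3" 1] q by simp
  have x1: "x > -1" using x by linarith
  have lo: "(1 + x) powr (- q) - 1 + q * x \<ge> 0"
    using powr_minus_ge_linear[OF x1 q] by simp
  have up: "(1 + x) powr (- q) - 1 + q * x \<le> q * (x * (1 - (1 + x) powr (- q - 1)))"
    using powr_minus_le_tangent[OF x1 q] by (simp add: algebra_simps)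
  have "x * (1 - (1 + x) powr (- q - 1)) \<le> (q + 1) * K * x\<^sup>2"
  proof (cases "x \<ge> 0")
    case True
    have "1 - (1 + x) powr (- q - 1) \<le> (q + 1) * x"
      using powr_minus_ge_linear[OF x1, of "q + 1"] q by simp
    also have "\<dots> \<le> (q + 1) * K * x"
      using K q True mult_right_mono[of 1 K "(q + 1) * x"] by (simp add: algebra_simps)
    finally have "x * (1 - (1 + x) powr (- q - 1)) \<le> x * ((q + 1) * K * x)"
      using True by (rule mult_left_mono)
    then show ?thesis by (simp add: power2_eq_square algebra_simps)
  next
    case False
    have "(1 + x) powr (- q - 2) \<le> K"
      unfolding K_def by (rule powr_mono2') (use x q in auto)
    then have "(q + 1) * (- x) * (1 + x) powr (- q - 2) \<le> (q + 1) * (- x) * K"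
      using False q by (intro mult_left_mono mult_nonneg_nonneg) auto
    moreover have "(1 + x) powr (- q - 1) \<le> 1 + (q + 1) * (- x) * (1 + x) powr (- q - 2)"
    proof -
      have e: "- (q + 1) = - q - 1" "- q - 1 - 1 = - q - 2" by simp_all
      show ?thesis
        using powr_minus_le_tangent[OF x1, of "q + 1", unfolded e] q by linarith
    qed
    ultimately have "(1 + x) powr (- q - 1) - 1 \<le> (q + 1) * (- x) * K" by linarith
    then have "(- x) * ((1 + x) powr (- q - 1) - 1) \<le> (- x) * ((q + 1) * (- x) * K)"
      by (rule mult_left_mono) (use False in simp)
    then show ?thesis by (simp add: power2_eq_square algebra_simps)
  qed
  then have "q * (x * (1 - (1 + x) powr (- q - 1))) \<le> q * ((q + 1) * K * x\<^sup>2)"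
    using q by (intro mult_left_mono) auto
  then show ?thesis using lo up by (simp add: K_def algebra_simps)
qed

section \<open>The function \<open>\<phi>\<close>\<close>

text \<open>Carries \<open>phi_digits_step\<close> over to \<open>phi\<close>: shifting an expansion
  of y gives one of (d + y) / p. Including y = 1 is legitimate since \<open>phi\<close> is
  independent of the expansion.\<close>

lemma phi_prepend_digit:
  assumes p: "p \<ge> 2" and d: "d \<le> p - 1" and y: "0 \<le> y" "y \<le> 1"
  shows "phi p ((real d + y) / real p) = (real d + 1) / binA p * (real d / 2 + phi p y)"
proof -
  obtain b where b: "base_expansion p b y" using base_expansion_exists[OF p y] by blast
  define c where "c j = (if j = 1 then d else b (j - 1))" for j
  have cS: "c (Suc (Suc j)) = b (Suc j)" "c (Suc 0) = d" for j by (auto simp: c_def)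
  have "(\<lambda>j. real (b (Suc j)) / real p ^ Suc j) sums y"
    using b by (simp add: base_expansion_def)
  from sums_divide[OF this, of "real p"]
  have "(\<lambda>j. real (c (Suc (Suc j))) / real p ^ Suc (Suc j)) sums (y / real p)"
    by (simp add: cS mult.commute)
  then have "(\<lambda>j. real (c (Suc j)) / real p ^ Suc j) sums (y / real p + real d / real p)"
    using sums_Suc_iff[of "\<lambda>j. real (c (Suc j)) / real p ^ Suc j" "y / real p"] by (simp add: cS)
  moreover have cb: "\<forall>j\<ge>1. c j \<le> p - 1"
    using b d by (auto simp: c_def base_expansion_def)
  ultimately have c: "base_expansion p c ((real d + y) / real p)"
    by (simp add: base_expansion_def add_divide_distrib add.commute)
  have tl: "real p * ((real d + y) / real p) - real (c 1) = y" using p by (simp add: c_def)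
  have "phi_digits p (\<lambda>j. c (Suc j)) = phi p y"
    using phi_base_expansion[OF p base_expansion_tail[OF p c]] unfolding tl by simp
  then show ?thesis
    using phi_base_expansion[OF p c] phi_digits_step[OF p cb] by (simp add: cS)
qed

lemma phi_bounds:
  assumes p: "p \<ge> 2" and x: "0 \<le> x" "x \<le> 1"
  shows "0 \<le> phi p x" "phi p x \<le> 1"
proof -
  obtain b where b: "base_expansion p b x" using base_expansion_exists[OF p x] by blast
  then have "\<forall>j\<ge>1. b j \<le> p - 1" by (auto simp: base_expansion_def)
  then show "0 \<le> phi p x" "phi p x \<le> 1"
    using phi_base_expansion[OF p b] phi_digits_bounds[OF p] by auto
qed

text \<open>A positive number has a nonzero digit, whose term is positive.\<close>

lemma phi_pos:
  assumes p: "p \<ge> 2" and x: "0 < x" "x \<le> 1"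
  shows "0 < phi p x"
proof -
  obtain b where b: "base_expansion p b x" using base_expansion_exists[OF p, of x] x by auto
  then have bd: "\<forall>j\<ge>1. b j \<le> p - 1"
    and s: "(\<lambda>j. real (b (Suc j)) / real p ^ Suc j) sums x"
    by (auto simp: base_expansion_def)
  have "\<exists>j. b (Suc j) \<noteq> 0"
  proof (rule ccontr)
    assume "\<nexists>j. b (Suc j) \<noteq> 0"
    then have "(\<lambda>j. 0 :: real) sums x" using s by simp
    then show False using sums_unique2[OF sums_zero] x by fastforce
  qed
  then obtain j where "b (Suc j) \<noteq> 0" by blast
  then have "phi_term p b j > 0"
    unfolding phi_term_def using binA_pos[OF p]
    by (intro mult_pos_pos divide_pos_pos prod_pos) auto
  then have "suminf (phi_term p b) > 0"
    using suminf_pos2[OF phi_term_summable[OF p bd]] phi_term_nonneg by blast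
  then show ?thesis using phi_base_expansion[OF p b] by (simp add: phi_digits_eq)
qed

lemma leading_digit_exists:
  assumes p: "p \<ge> 2" and x: "0 \<le> x" "x \<le> 1"
  obtains d y where "d \<le> p - 1" "0 \<le> y" "y \<le> 1" "x = (real d + y) / real p"
proof -
  obtain b where b: "base_expansion p b x" using base_expansion_exists[OF p x] by blast
  show ?thesis
  proof (rule that[of "b 1" "real p * x - real (b 1)"])
    show "b 1 \<le> p - 1" using b by (simp add: base_expansion_def)
    show "0 \<le> real p * x - real (b 1)" "real p * x - real (b 1) \<le> 1"
      using base_expansion_range[OF p base_expansion_tail[OF p b]] by auto
    show "x = (real (b 1) + (real p * x - real (b 1))) / real p" using p by simp
  qed
qed

text \<open>Monotonicity is obtained as a limit of approximate statements, because comparing leading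
  digits may reduce \<open>x \<le> y\<close> to the tails indefinitely.\<close>

lemma phi_mono:
  assumes p: "p \<ge> 2" and xy: "0 \<le> x" "x \<le> y" "y \<le> 1"
  shows "phi p x \<le> phi p y"
proof -
  define r where "r = 2 / (real p + 1)"
  have r: "0 \<le> r" "r < 1" using p by (auto simp: r_def)
  have A: "binA p > 0" by (rule binA_pos[OF p])
  \<comment> \<open>\<open>r\<close> = p / A is the largest slope of a digit map; each shared
    leading digit gains one such factor.\<close>
  have bound: "phi p x - phi p y \<le> r ^ n" if "0 \<le> x" "x \<le> y" "y \<le> 1" for n x y
    using that
  proof (induction n arbitrary: x y)
    case 0
    then show ?case using phi_bounds[OF p, of x] phi_bounds[OF p, of y] by simp
  next
    case (Suc n)
    obtain d u where d: "d \<le> p - 1" "0 \<le> u" "u \<le> 1" "x = (real d + u) / real p"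
      using leading_digit_exists[OF p, of x] Suc.prems by auto
    obtain e v where e: "e \<le> p - 1" "0 \<le> v" "v \<le> 1" "y = (real e + v) / real p"
      using leading_digit_exists[OF p, of y] Suc.prems by auto
    have le: "real d + u \<le> real e + v"
      using Suc.prems(2) p d(4) e(4) by (simp add: divide_le_cancel)
    have fx: "phi p x = (real d + 1) / binA p * (real d / 2 + phi p u)"
      unfolding d(4) by (rule phi_prepend_digit[OF p d(1-3)])
    have fy: "phi p y = (real e + 1) / binA p * (real e / 2 + phi p v)"
      unfolding e(4) by (rule phi_prepend_digit[OF p e(1-3)])
    consider "x = y" | "d = e" | "d < e" | "e < d" by linarith
    then show ?case
    proof cases
      case 1
      then show ?thesis using r by simp
    next
      case 2
      have "(real d + 1) / binA p \<le> real p / binA p"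
        using A d(1) p by (intro divide_right_mono) linarith+
      then have q: "0 \<le> (real d + 1) / binA p" "(real d + 1) / binA p \<le> r"
        using A by (auto simp: r_def p_over_binA[OF p])
      have "phi p x - phi p y = (real d + 1) / binA p * (phi p u - phi p v)"
        unfolding fx fy 2 by (simp add: algebra_simps diff_divide_distrib)
      also have "\<dots> \<le> (real d + 1) / binA p * r ^ n"
        using Suc.IH[of u v] le 2 d e q by (intro mult_left_mono) auto
      also have "\<dots> \<le> r * r ^ n" using q r by (intro mult_right_mono) auto
      finally show ?thesis by simp
    next
      case 3
      \<comment> \<open>Cells of different digits are ordered: the right end value (d+1)(d+2)/(2A)
        of cell d is at most the left end value e(e+1)/(2A) of cell e.\<close>
      have "phi p x \<le> (real d + 1) / binA p * (real d / 2 + 1)"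
        unfolding fx using phi_bounds[OF p d(2,3)] A by (intro mult_left_mono) auto
      also have "\<dots> = (real d + 1) * (real d + 2) / (2 * binA p)"
        by (simp add: field_simps)
      also have "\<dots> \<le> real e * (real e + 1) / (2 * binA p)"
        using A 3 by (intro divide_right_mono mult_mono) auto
      also have "\<dots> = (real e + 1) / binA p * (real e / 2)"
        by (simp add: field_simps)
      also have "\<dots> \<le> phi p y"
        unfolding fy using phi_bounds[OF p e(2,3)] A by (intro mult_left_mono) auto
      finally show ?thesis using r by (meson diff_le_0_iff_le order_trans zero_le_power)
    next
      case 4
      \<comment> \<open>Only x = y is compatible with e < d: a common endpoint of two adjacent
        cells.\<close>
      then have "real e + 1 \<le> real d" by linarith
      then have "real d + u = real e + v" using le d e by linarith
      then have "x = y" using d(4) e(4) by simp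
      then show ?thesis using r by simp
    qed
  qed
  have "(\<lambda>n. r ^ n) \<longlonglongrightarrow> 0" using r by (intro LIMSEQ_power_zero) auto
  then have "phi p x - phi p y \<le> 0"
    by (rule LIMSEQ_le_const) (use bound[OF xy] in auto)
  then show ?thesis by simp
qed

section \<open>Self-similarity of \<open>phi\<close>\<close>

text \<open>Iterates \<open>phi_prepend_digit\<close>; the additive parts cancel in the difference
  and the slopes multiply to \<tau>. The induction moves the last digit into the arguments, hence
  arbitrary u and v.\<close>

lemma phi_prepend_block:
  assumes p: "p \<ge> 2" and a: "\<And>i. i \<in> {1..M} \<Longrightarrow> a i \<le> p - 1"
    and u: "0 \<le> u" "u \<le> 1" and v: "0 \<le> v" "v \<le> 1"
  shows "phi p ((real (\<Sum>i = 1..M. a i * p ^ (M - i)) + u) / real p ^ M)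
       - phi p ((real (\<Sum>i = 1..M. a i * p ^ (M - i)) + v) / real p ^ M)
       = tau p M a * (phi p u - phi p v)"
  using a u v
proof (induction M arbitrary: u v)
  case 0
  then show ?case by (simp add: tau_def)
next
  case (Suc M)
  let ?S = "real (\<Sum>i = 1..M. a i * p ^ (M - i))"
  let ?d = "a (Suc M)"
  have d: "?d \<le> p - 1" using Suc.prems(1) by simp
  have S: "real (\<Sum>i = 1..Suc M. a i * p ^ (Suc M - i)) = real p * ?S + real ?d"
  proof -
    have "(\<Sum>i = 1..M. a i * p ^ (Suc M - i)) = p * (\<Sum>i = 1..M. a i * p ^ (M - i))"
      unfolding sum_distrib_left by (rule sum.cong) (auto simp: Suc_diff_le)
    then show ?thesis by (simp only: sum.cl_ivl_Suc) simp
  qed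
  have eq: "(real (\<Sum>i = 1..Suc M. a i * p ^ (Suc M - i)) + w) / real p ^ Suc M
      = (?S + (real ?d + w) / real p) / real p ^ M" for w
    unfolding S using p by (simp add: field_simps)
  have rng: "0 \<le> (real ?d + w) / real p" "(real ?d + w) / real p \<le> 1" if "0 \<le> w" "w \<le> 1" for w
  proof -
    have "real ?d + w \<le> real p" using d that p by linarith
    then show "0 \<le> (real ?d + w) / real p" "(real ?d + w) / real p \<le> 1" using that p by auto
  qed
  note uv = Suc.prems(2-5)
  have "phi p ((?S + (real ?d + u) / real p) / real p ^ M)
      - phi p ((?S + (real ?d + v) / real p) / real p ^ M)
      = tau p M a * (phi p ((real ?d + u) / real p) - phi p ((real ?d + v) / real p))"
    using Suc.prems(1) by (intro Suc.IH rng uv) auto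
  also have "\<dots> = tau p M a * ((real ?d + 1) / binA p) * (phi p u - phi p v)"
    unfolding phi_prepend_digit[OF p d uv(1,2)] phi_prepend_digit[OF p d uv(3,4)]
    by (simp add: algebra_simps diff_divide_distrib)
  also have "tau p M a * ((real ?d + 1) / binA p) = tau p (Suc M) a"
    by (simp add: tau_def algebra_simps)
  finally show ?case unfolding eq .
qed

lemma shrink_to_half_range:
  fixes t :: real
  assumes p: "p \<ge> 1" and t: "0 \<le> t" "t \<le> 1"
  shows "0 \<le> 1/2 + (t - 1/2) / real p ^ k" "1/2 + (t - 1/2) / real p ^ k \<le> 1"
proof -
  have pk: "real p ^ k \<ge> 1" using p by simp
  have "\<bar>t - 1/2\<bar> / real p ^ k \<le> \<bar>t - 1/2\<bar>"
    using divide_left_mono[OF pk, of "\<bar>t - 1/2\<bar>"] p by simp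
  moreover have "\<bar>t - 1/2\<bar> \<le> 1/2" using t by linarith
  moreover have "\<bar>(t - 1/2) / real p ^ k\<bar> = \<bar>t - 1/2\<bar> / real p ^ k" by simp
  ultimately have "\<bar>(t - 1/2) / real p ^ k\<bar> \<le> 1/2" by linarith
  then show "0 \<le> 1/2 + (t - 1/2) / real p ^ k" "1/2 + (t - 1/2) / real p ^ k \<le> 1"
    by linarith+
qed

text \<open>The slope \<open>1 / p\<close> of the middle digit makes \<open>\<phi>\<close> exactly self-similar around \<open>1/2\<close> with the same
  ratio in both coordinates.\<close>

lemma phi_shrink_to_half:
  assumes p: "p \<ge> 2" and "odd p" and t: "0 \<le> t" "t \<le> 1"
  shows "phi p (1/2 + (t - 1/2) / real p ^ k) - phi p (1/2) = (phi p t - phi p (1/2)) / real p ^ k"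
proof (induction k)
  case 0
  then show ?case by simp
next
  case (Suc k)
  let ?x = "1/2 + (t - 1/2) / real p ^ k"
  \<comment> \<open>d = (p - 1) / 2 is the middle digit, and 1/2 is the fixed point of y \<mapsto>
    (d + y) / p.\<close>
  obtain d where d: "p = 2 * d + 1" using \<open>odd p\<close> by (rule oddE)
  have x: "0 \<le> ?x" "?x \<le> 1" using shrink_to_half_range[of p t k] p t by auto
  have slope: "(real d + 1) / binA p = 1 / real p"
  proof -
    have "binA p = real p * (real d + 1)" by (simp add: binA_eq d)
    moreover have "real d + 1 > 0" by simp
    ultimately show ?thesis using p by simp
  qed
  have shift: "1/2 + (t - 1/2) / real p ^ Suc k = (real d + ?x) / real p"
  proof -
    have "real d + ?x = real p / 2 + (t - 1/2) / real p ^ k" by (simp add: d)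
    then have "(real d + ?x) / real p = (real p / 2 + (t - 1/2) / real p ^ k) / real p"
      by (simp only:)
    also have "\<dots> = 1/2 + (t - 1/2) / real p ^ Suc k"
      unfolding add_divide_distrib using p by (simp add: mult.commute)
    finally show ?thesis ..
  qed
  have half: "1/2 = (real d + 1/2) / real p" by (simp add: d field_simps)
  have "phi p (1/2 + (t - 1/2) / real p ^ Suc k) - phi p (1/2)
      = phi p ((real d + ?x) / real p) - phi p ((real d + 1/2) / real p)"
    by (simp only: shift flip: half)
  also have "\<dots> = 1 / real p * (phi p ?x - phi p (1/2))"
  proof -
    have "d \<le> p - 1" by (simp add: d)
    then have "phi p ((real d + w) / real p) = 1 / real p * (real d / 2 + phi p w)"
      if "0 \<le> w" "w \<le> 1" for w
      using phi_prepend_digit[OF p _ that] by (simp only: slope)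
    from this[OF x] this[of "1/2"] show ?thesis
      by (simp only: right_diff_distrib distrib_left)
  qed
  finally show ?case unfolding Suc by simp
qed

section \<open>Local behaviour of \<open>G\<close> at \<open>\<mu>\<close>\<close>

text \<open>The middle digits telescope, (p - 1) / (2 p^j) = 1 / (2 p^(j-1)) - 1 / (2 p^j), so
  \<open>theta\<close> maps [0,1] affinely onto \<open>Iv\<close> with 1/2 going to \<mu>.\<close>

lemma theta_eq:
  assumes p: "p \<ge> 2"
  shows "theta p M m k t = mu p M m + (t - 1/2) / real p ^ (M + k)"
proof -
  have "(\<Sum>j\<in>{M<..M + k}. (real p - 1) / (2 * real p ^ j))
      = 1 / (2 * real p ^ M) - 1 / (2 * real p ^ (M + k))"
  proof (induction k)
    case 0
    then show ?case by simp
  next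
    case (Suc k)
    have "{M<..M + Suc k} = insert (Suc (M + k)) {M<..M + k}" by auto
    then have "(\<Sum>j\<in>{M<..M + Suc k}. (real p - 1) / (2 * real p ^ j))
        = (real p - 1) / (2 * real p ^ Suc (M + k)) + (1 / (2 * real p ^ M) - 1 / (2 * real p ^ (M + k)))"
      by (simp add: Suc)
    also have "(real p - 1) / (2 * real p ^ Suc (M + k))
        = 1 / (2 * real p ^ (M + k)) - 1 / (2 * real p ^ (M + Suc k))"
      using p by (simp add: diff_divide_distrib)
    finally show ?case by simp
  qed
  then show ?thesis by (simp add: theta_def mu_def add_divide_distrib diff_divide_distrib)
qed

lemma rho_pos:
  assumes p: "p \<ge> 2"
  shows "rho p > 0"
proof -
  have "2 * 3 \<le> real p * (real p + 1)" using p by (intro mult_mono) auto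
  then have "binA p > 1" by (simp add: binA_eq)
  then show ?thesis using p by (simp add: rho_def)
qed

lemma tau_pos: "p \<ge> 2 \<Longrightarrow> tau p M a > 0"
  unfolding tau_def using binA_pos by (intro divide_pos_pos prod_pos) auto

text \<open>By monotonicity phi(t) - phi(1/2) and t - 1/2 never have opposite signs, so only the
  factor p^-(M+k) matters. A hypothesis at level k thereby carries over to all finer levels.\<close>

lemma Emu_antimono:
  assumes p: "p \<ge> 2" and t: "0 \<le> t" "t \<le> 1" and kl: "k \<le> l"
  shows "Emu p M a l t \<le> Emu p M a k t"
proof -
  have nn: "(phi p t - phi p (1/2)) * (t - 1/2) \<ge> 0"
  proof (cases "t \<le> 1/2")
    case True
    then show ?thesis using phi_mono[OF p, of t "1/2"] t by (intro mult_nonpos_nonpos) auto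
  next
    case False
    then show ?thesis using phi_mono[OF p, of "1/2" t] t by (intro mult_nonneg_nonneg) auto
  qed
  have "tau p M a * rho p / real p ^ (M + l) \<le> tau p M a * rho p / real p ^ (M + k)"
    using tau_pos[OF p, of M a] rho_pos[OF p] kl p
    by (intro divide_left_mono power_increasing) auto
  from mult_right_mono[OF this nn] show ?thesis by (simp add: Emu_def mult.assoc)
qed

locale half_integer_point =
  fixes p M m :: nat and a :: "nat \<Rightarrow> nat"
  assumes p3: "p \<ge> 3" and odd_p: "odd p" and m_pos: "1 \<le> m" and m_less: "m < p ^ M"
    and digits: "\<And>i. i \<in> {1..M} \<Longrightarrow> a i \<le> p - 1"
    and m_eq: "m = (\<Sum>i = 1..M. a i * p ^ (M - i))"
begin

abbreviation "\<mu> \<equiv> mu p M m"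
abbreviation "\<rho> \<equiv> rho p"
abbreviation "\<Delta> t \<equiv> phi p t - phi p (1/2)"

text \<open>By \<open>theta_eq\<close> this is (\<theta> - \<mu>) / \<mu>, the x of the
  expansion.\<close>

definition reldev :: "nat \<Rightarrow> real \<Rightarrow> real" where
  "reldev k t = (t - 1/2) / (\<mu> * real p ^ (M + k))"

lemma p2: "p \<ge> 2"
  using p3 by simp

lemma mu_pos: "\<mu> > 0"
  using p3 by (simp add: mu_def)

lemma mu_le_1: "\<mu> \<le> 1"
proof -
  have "m + 1 \<le> p ^ M" using m_less by simp
  then have "real m + 1/2 \<le> real p ^ M"
    by (simp flip: of_nat_power)
  then show ?thesis using p3 by (simp add: mu_def)
qed

lemma theta_eq_mu_mult: "theta p M m k t = \<mu> * (1 + reldev k t)"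
  unfolding theta_eq[OF p2] reldev_def using mu_pos by (simp add: distrib_left)

text \<open>The constant 1/3 is (1/2) / (3/2), because \<mu> p^M = m + 1/2 \<ge> 3/2 for m \<ge>
  1.\<close>

lemma abs_reldev_le:
  assumes t: "0 \<le> t" "t \<le> 1"
  shows "\<bar>reldev k t\<bar> \<le> 1 / 3 / real p ^ k"
proof -
  have "\<mu> * real p ^ (M + k) = (real m + 1/2) * real p ^ k"
    using p3 by (simp add: mu_def power_add)
  then have "\<bar>reldev k t\<bar> = \<bar>t - 1/2\<bar> / (real m + 1/2) / real p ^ k"
    unfolding reldev_def by (simp add: abs_mult)
  also have "\<dots> \<le> (1/2) / (3/2) / real p ^ k"
  proof (intro divide_right_mono frac_le)
    show "\<bar>t - 1/2\<bar> \<le> 1/2" using t by linarith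
  qed (use m_pos in auto)
  finally show ?thesis by simp
qed

lemma abs_reldev_le_third:
  assumes t: "0 \<le> t" "t \<le> 1"
  shows "\<bar>reldev k t\<bar> \<le> 1 / 3"
proof -
  have "1 / 3 / real p ^ k \<le> 1 / 3 / 1" using p3 by (intro divide_left_mono) auto
  then show ?thesis using abs_reldev_le[OF t, of k] by simp
qed

lemma theta_range:
  assumes t: "0 \<le> t" "t \<le> 1"
  shows "0 < theta p M m k t" "theta p M m k t \<le> 1"
proof -
  show "0 < theta p M m k t"
    unfolding theta_eq_mu_mult using abs_reldev_le_third[OF t, of k] mu_pos
    by (intro mult_pos_pos) auto
  have "m + 1 \<le> p ^ M" using m_less by simp
  then have "real m + 1 \<le> real p ^ M" by (simp flip: of_nat_power)
  moreover have "theta p M m k t = (real m + (1/2 + (t - 1/2) / real p ^ k)) / real p ^ M"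
    unfolding theta_eq[OF p2] mu_def using p3 by (simp add: field_simps power_add)
  ultimately show "theta p M m k t \<le> 1"
    using shrink_to_half_range(2)[of p t k] t p3 by (simp add: divide_le_eq)
qed

text \<open>\<theta> has the digits of m followed by 1/2 + (t - 1/2) / p^k, so the block and the
  middle digits contribute the factors \<tau> and p^-k exactly.\<close>

lemma phi_theta:
  assumes t: "0 \<le> t" "t \<le> 1"
  shows "phi p (theta p M m k t) = phi p \<mu> + tau p M a * \<Delta> t / real p ^ k"
proof -
  let ?u = "1/2 + (t - 1/2) / real p ^ k"
  have u: "0 \<le> ?u" "?u \<le> 1" using shrink_to_half_range[of p t k] t p3 by auto
  have "theta p M m k t = (real m + ?u) / real p ^ M"
    unfolding theta_eq[OF p2] mu_def using p3 by (simp add: field_simps power_add)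
  moreover have "phi p ((real m + ?u) / real p ^ M) - phi p ((real m + 1/2) / real p ^ M)
      = tau p M a * (phi p ?u - phi p (1/2))"
    using phi_prepend_block[of p M a ?u "1/2", folded m_eq] p2 digits u by simp
  ultimately show ?thesis
    unfolding phi_shrink_to_half[OF p2 odd_p t] by (simp add: mu_def)
qed

section \<open>Asymptotic expansion of \<open>G\<close>\<close>

text \<open>Exact identity: \<open>Qmu\<close> arises by replacing \<open>h\<close> with 1 before
  \<Delta> and with 1 - \<rho> x before phi(\<mu>), x being \<open>reldev k t\<close>; the other two
  summands are the errors of these replacements.\<close>

lemma G_theta_diff:
  fixes k :: nat and t :: real
  assumes t: "0 \<le> t" "t \<le> 1"
  defines "h \<equiv> (1 + reldev k t) powr (- \<rho>)"
  shows "real p ^ k * (G p (theta p M m k t) - G p \<mu>) = \<mu> powr (- \<rho> - 1) *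
     (Qmu p M m a t + (\<mu> * tau p M a * \<Delta> t * (h - 1)
        + \<mu> * real p ^ k * phi p \<mu> * (h - 1 + \<rho> * reldev k t)))"
proof -
  have "theta p M m k t powr (- \<rho>) = \<mu> powr (- \<rho>) * h"
    unfolding theta_eq_mu_mult h_def using mu_pos abs_reldev_le_third[OF t, of k]
    by (intro powr_mult)
  then have "real p ^ k * (G p (theta p M m k t) - G p \<mu>)
      = \<mu> powr (- \<rho>) * (h * (real p ^ k * phi p \<mu> + tau p M a * \<Delta> t) - real p ^ k * phi p \<mu>)"
    unfolding G_def phi_theta[OF t] using p3 by (simp add: field_simps)
  also have "\<mu> powr (- \<rho>) = \<mu> powr (- \<rho> - 1) * \<mu>"
    using mu_pos by (simp add: powr_diff)
  also have "\<mu> powr (- \<rho> - 1) * \<mu> *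
        (h * (real p ^ k * phi p \<mu> + tau p M a * \<Delta> t) - real p ^ k * phi p \<mu>)
      = \<mu> powr (- \<rho> - 1) *
        (\<mu> * (h * (real p ^ k * phi p \<mu> + tau p M a * \<Delta> t) - real p ^ k * phi p \<mu>))"
    by (simp add: mult.assoc)
  also have "\<mu> * (h * (real p ^ k * phi p \<mu> + tau p M a * \<Delta> t) - real p ^ k * phi p \<mu>)
      = Qmu p M m a t + (\<mu> * tau p M a * \<Delta> t * (h - 1)
        + \<mu> * real p ^ k * phi p \<mu> * (h - 1 + \<rho> * reldev k t))"
  proof -
    \<comment> \<open>The factor p^k cancels the one in \<open>reldev\<close>, so the linear term
      does not depend on k.\<close>
    have "\<mu> * real p ^ k * phi p \<mu> * (\<rho> * reldev k t)
        = \<rho> * phi p \<mu> / real p ^ M * (t - 1/2)"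
      unfolding reldev_def using mu_pos p3 by (simp add: power_add)
    then show ?thesis unfolding Qmu_def by (simp add: algebra_simps)
  qed
  finally show ?thesis .
qed

text \<open>The first error is O(x) and the second p^k O(x^2), with x = O(p^-k). The constant
  involves only \<tau>, \<rho> and \<open>K\<close>, none depending on k or t.\<close>

lemma G_theta_expansion:
  "\<exists>C. \<forall>k. \<forall>t\<in>{0..1}. \<exists>r. \<bar>r\<bar> \<le> C * real p powr (- real k) \<and>
     real p ^ k * (G p (theta p M m k t) - G p \<mu>) = \<mu> powr (- \<rho> - 1) * (Qmu p M m a t + r)"
proof -
  define K where "K = \<rho> * (\<rho> + 1) * (2/3) powr (- \<rho> - 2)"
  have \<rho>: "\<rho> > 0" by (rule rho_pos[OF p2])
  have K: "K \<ge> 0" using \<rho> by (simp add: K_def)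
  have \<tau>: "tau p M a > 0" by (rule tau_pos[OF p2])
  have "\<exists>r. \<bar>r\<bar> \<le> (tau p M a * (\<rho> + K) + K) * real p powr (- real k) \<and>
      real p ^ k * (G p (theta p M m k t) - G p \<mu>) = \<mu> powr (- \<rho> - 1) * (Qmu p M m a t + r)"
    if t: "0 \<le> t" "t \<le> 1" for k t
  proof (intro exI conjI)
    let ?x = "reldev k t"
    define h where "h = (1 + ?x) powr (- \<rho>)"
    show "real p ^ k * (G p (theta p M m k t) - G p \<mu>) = \<mu> powr (- \<rho> - 1) *
       (Qmu p M m a t + (\<mu> * tau p M a * \<Delta> t * (h - 1)
          + \<mu> * real p ^ k * phi p \<mu> * (h - 1 + \<rho> * ?x)))"
      unfolding h_def by (rule G_theta_diff[OF t])
    have x3: "\<bar>?x\<bar> \<le> 1" using abs_reldev_le_third[OF t, of k] by simp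
    have xk: "\<bar>?x\<bar> \<le> 1 / real p ^ k"
      using abs_reldev_le[OF t, of k] divide_right_mono[of "1/3" 1 "real p ^ k"] by linarith
    have e2: "\<bar>h - 1 + \<rho> * ?x\<bar> \<le> K * ?x\<^sup>2"
      unfolding h_def K_def by (rule powr_minus_linear_error[OF abs_reldev_le_third[OF t] \<rho>])
    have "?x\<^sup>2 = \<bar>?x\<bar> * \<bar>?x\<bar>" by (simp add: power2_eq_square)
    also have "\<dots> \<le> \<bar>?x\<bar> * 1" using x3 by (intro mult_left_mono) auto
    finally have "K * ?x\<^sup>2 \<le> K * \<bar>?x\<bar>" using K by (intro mult_left_mono) auto
    moreover have "\<bar>h - 1\<bar> \<le> \<bar>h - 1 + \<rho> * ?x\<bar> + \<rho> * \<bar>?x\<bar>"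
      using abs_triangle_ineq4[of "h - 1 + \<rho> * ?x" "\<rho> * ?x"] \<rho> by (simp add: abs_mult)
    ultimately have "\<bar>h - 1\<bar> \<le> (\<rho> + K) * \<bar>?x\<bar>" using e2 by (simp add: algebra_simps)
    also have "\<dots> \<le> (\<rho> + K) * (1 / real p ^ k)"
      using xk \<rho> K by (intro mult_left_mono) auto
    finally have e1: "\<bar>h - 1\<bar> \<le> (\<rho> + K) * (1 / real p ^ k)" .
    have \<Delta>: "\<bar>\<Delta> t\<bar> \<le> 1"
      using phi_bounds[OF p2 t] phi_bounds[OF p2, of "1/2"] by (simp add: abs_le_iff)
    have \<phi>: "0 \<le> phi p \<mu>" "phi p \<mu> \<le> 1"
      using phi_bounds[OF p2, of \<mu>] mu_pos mu_le_1 by auto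
    have "\<bar>\<mu> * tau p M a * \<Delta> t * (h - 1)\<bar> = \<mu> * tau p M a * \<bar>\<Delta> t\<bar> * \<bar>h - 1\<bar>"
      using mu_pos \<tau> by (simp add: abs_mult)
    also have "\<dots> \<le> 1 * tau p M a * 1 * ((\<rho> + K) * (1 / real p ^ k))"
      using mu_pos mu_le_1 \<tau> \<Delta> e1 \<rho> K by (intro mult_mono) auto
    finally have r1: "\<bar>\<mu> * tau p M a * \<Delta> t * (h - 1)\<bar>
        \<le> tau p M a * (\<rho> + K) * (1 / real p ^ k)" by simp
    have "\<bar>?x\<bar>\<^sup>2 \<le> (1 / real p ^ k)\<^sup>2" using xk by (intro power_mono) auto
    then have "K * ?x\<^sup>2 \<le> K * (1 / real p ^ k)\<^sup>2" using K by (intro mult_left_mono) auto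
    with e2 have e2': "\<bar>h - 1 + \<rho> * ?x\<bar> \<le> K * (1 / real p ^ k)\<^sup>2" by linarith
    have "\<bar>\<mu> * real p ^ k * phi p \<mu> * (h - 1 + \<rho> * ?x)\<bar>
        = \<mu> * real p ^ k * phi p \<mu> * \<bar>h - 1 + \<rho> * ?x\<bar>"
      using mu_pos \<phi> by (simp add: abs_mult)
    also have "\<dots> \<le> 1 * real p ^ k * 1 * (K * (1 / real p ^ k)\<^sup>2)"
      using mu_pos mu_le_1 \<phi> e2' K by (intro mult_mono) auto
    also have "\<dots> = K * (1 / real p ^ k)" using p3 by (simp add: power2_eq_square)
    finally have r2: "\<bar>\<mu> * real p ^ k * phi p \<mu> * (h - 1 + \<rho> * ?x)\<bar> \<le> K * (1 / real p ^ k)" .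
    have pk: "real p powr (- real k) = 1 / real p ^ k"
      using p3 by (simp add: powr_minus powr_realpow divide_inverse)
    show "\<bar>\<mu> * tau p M a * \<Delta> t * (h - 1) + \<mu> * real p ^ k * phi p \<mu> * (h - 1 + \<rho> * ?x)\<bar>
        \<le> (tau p M a * (\<rho> + K) + K) * real p powr (- real k)"
      unfolding pk using r1 r2 abs_triangle_ineq
      by (smt (verit, best) distrib_right)
  qed
  then show ?thesis by (intro exI[of _ "tau p M a * (\<rho> + K) + K"]) auto
qed

section \<open>Strict minimum at \<mu>\<close>

text \<open>The errors regroup with weight phi(\<theta>) instead of phi(\<mu>): one term is positive
  by strict Bernoulli and phi(\<theta>) > 0, the other is exactly
  \<open>- Emu p M a k t\<close>.\<close>

lemma G_mu_less_G_theta: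
  assumes t: "0 \<le> t" "t \<le> 1" "t \<noteq> 1/2" and QE: "Emu p M a k t \<le> Qmu p M m a t"
  shows "G p \<mu> < G p (theta p M m k t)"
proof -
  let ?x = "reldev k t"
  define h where "h = (1 + ?x) powr (- \<rho>)"
  define \<phi> where "\<phi> = phi p (theta p M m k t)"
  have "0 < \<phi>"
    unfolding \<phi>_def using phi_pos[OF p2] theta_range[OF t(1,2)] by blast
  have "?x \<noteq> 0" using t mu_pos p3 by (simp add: reldev_def)
  moreover have "?x > -1" using abs_reldev_le_third[OF t(1,2), of k] by linarith
  ultimately have "h - 1 + \<rho> * ?x > 0"
    using powr_minus_gt_linear[of ?x \<rho>] rho_pos[OF p2] unfolding h_def by simp
  with \<open>0 < \<phi>\<close> have pos: "\<mu> * real p ^ k * \<phi> * (h - 1 + \<rho> * ?x) > 0"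
    using mu_pos p3 by simp
  have \<phi>: "real p ^ k * \<phi> = real p ^ k * phi p \<mu> + tau p M a * \<Delta> t"
    unfolding \<phi>_def phi_theta[OF t(1,2)] using p3 by (simp add: field_simps)
  \<comment> \<open>\<open>Emu\<close> is the cross term of the increment of \<open>phi\<close> with
    the linear term \<rho> x.\<close>
  have E: "\<mu> * tau p M a * \<Delta> t * (\<rho> * ?x) = Emu p M a k t"
    unfolding Emu_def reldev_def using mu_pos by simp
  have "\<mu> * tau p M a * \<Delta> t * (h - 1) + \<mu> * real p ^ k * phi p \<mu> * (h - 1 + \<rho> * ?x)
      = \<mu> * (real p ^ k * phi p \<mu> + tau p M a * \<Delta> t) * (h - 1 + \<rho> * ?x)
        - \<mu> * tau p M a * \<Delta> t * (\<rho> * ?x)"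
    by (simp add: algebra_simps)
  also have "\<dots> = \<mu> * real p ^ k * \<phi> * (h - 1 + \<rho> * ?x) - Emu p M a k t"
    unfolding E \<phi>[symmetric] by simp
  finally have "Qmu p M m a t + (\<mu> * tau p M a * \<Delta> t * (h - 1)
        + \<mu> * real p ^ k * phi p \<mu> * (h - 1 + \<rho> * ?x)) > 0"
    using pos QE by linarith
  then have "real p ^ k * (G p (theta p M m k t) - G p \<mu>) > 0"
    unfolding G_theta_diff[OF t(1,2)] h_def using mu_pos by (intro mult_pos_pos) auto
  then show ?thesis by (simp add: zero_less_mult_iff)
qed

text \<open>Take the last level at which the interval around \<mu> still contains s. Rescaled there,
  s has distance at least 1 / (2p) from 1/2, having left the next interval, which is p times
  shorter.\<close>

lemma outer_representation:
  assumes s: "s \<in> Iv p M m k" and ne: "s \<noteq> \<mu>"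
  obtains l t where "l \<ge> k" "t \<in> {0 .. 1/2 - 1 / (2 * real p)} \<union> {1/2 + 1 / (2 * real p) .. 1}"
    "s = theta p M m l t"
proof -
  \<comment> \<open>\<open>P n\<close>: s lies outside the interval of level k + n.\<close>
  define P where "P n \<longleftrightarrow> \<bar>s - \<mu>\<bar> * real p ^ (M + k + n) > 1/2" for n
  have "\<exists>n. P n"
  proof -
    obtain n where n: "real p ^ n > 1 / (2 * \<bar>s - \<mu>\<bar>)"
      using real_arch_pow[of "real p"] p3 by auto
    have "real p ^ n \<le> real p ^ (M + k + n)" using p3 by (intro power_increasing) auto
    with n have "real p ^ (M + k + n) > 1 / (2 * \<bar>s - \<mu>\<bar>)" by linarith
    then have "P n" unfolding P_def using ne by (simp add: field_simps)
    then show ?thesis ..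
  qed
  moreover have P0: "\<not> P 0"
  proof -
    have "\<bar>s - \<mu>\<bar> \<le> 1 / (2 * real p ^ (M + k))"
      using s by (auto simp: Iv_def abs_le_iff)
    then have "\<bar>s - \<mu>\<bar> * real p ^ (M + k) \<le> 1 / (2 * real p ^ (M + k)) * real p ^ (M + k)"
      by (rule mult_right_mono) simp
    then show ?thesis using p3 by (simp add: P_def)
  qed
  ultimately obtain n where n: "\<not> P n" "P (Suc n)"
    using ex_least_nat_less[of P] by blast
  define t where "t = 1/2 + (s - \<mu>) * real p ^ (M + (k + n))"
  have u: "\<bar>t - 1/2\<bar> = \<bar>s - \<mu>\<bar> * real p ^ (M + k + n)"
    by (simp add: t_def abs_mult add.assoc)
  have "\<bar>t - 1/2\<bar> \<le> 1/2" using n(1) unfolding P_def u by simp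
  moreover have "\<bar>t - 1/2\<bar> * real p > 1/2" using n(2) unfolding P_def u by (simp add: mult_ac)
  then have "\<bar>t - 1/2\<bar> \<ge> 1 / (2 * real p)" using p3 by (simp add: field_simps)
  ultimately have "t \<in> {0 .. 1/2 - 1 / (2 * real p)} \<union> {1/2 + 1 / (2 * real p) .. 1}"
    by (auto simp: abs_if split: if_splits)
  moreover have "s = theta p M m (k + n) t"
    unfolding theta_eq[OF p2] t_def using p3 by simp
  ultimately show ?thesis using that[of "k + n" t] by simp
qed

lemma G_mu_strict_minimum:
  assumes QE: "\<forall>t\<in>{0 .. 1/2 - 1 / (2 * real p)} \<union> {1/2 + 1 / (2 * real p) .. 1}.
      Emu p M a k t \<le> Qmu p M m a t"
    and s: "s \<in> Iv p M m k" "s \<noteq> \<mu>"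
  shows "G p \<mu> < G p s"
proof -
  obtain l t where l: "l \<ge> k"
    and t: "t \<in> {0 .. 1/2 - 1 / (2 * real p)} \<union> {1/2 + 1 / (2 * real p) .. 1}"
    and s_eq: "s = theta p M m l t"
    using outer_representation[OF s] by blast
  have p0: "1 / (2 * real p) > 0" using p3 by simp
  have t01: "0 \<le> t" "t \<le> 1" "t \<noteq> 1/2"
    using t p0 unfolding Un_iff atLeastAtMost_iff by linarith+
  \<comment> \<open>\<open>Qmu\<close> is independent of the level, so the bound at k gives the
    bound at l.\<close>
  have "Emu p M a l t \<le> Qmu p M m a t"
    using Emu_antimono[OF p2 t01(1,2) l, of M a] bspec[OF QE t] by (rule order_trans)
  then show ?thesis unfolding s_eq by (rule G_mu_less_G_theta[OF t01])
qed

end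

text \<open>Choosing \<open>C\<close> before k and t expresses uniformity; the digits
  \<open>a 1\<close>, ..., \<open>a M\<close> are determined by p, M and m.\<close>

theorem theorem3p3:
  fixes p M m :: nat and a :: "nat \<Rightarrow> nat"
  assumes "prime p" and "odd p"
    and "M \<ge> 1" and "1 \<le> m" and "m < p ^ M"
    and "\<And>i. i \<in> {1..M} \<Longrightarrow> a i \<le> p - 1"
    and "m = (\<Sum>i = 1..M. a i * p ^ (M - i))"
  shows "(\<exists>C. \<forall>k. \<forall>t\<in>{0..1}. \<exists>r. \<bar>r\<bar> \<le> C * real p powr (- real k) \<and>
            real p ^ k * (G p (theta p M m k t) - G p (mu p M m)) =
              mu p M m powr (- rho p - 1) * (Qmu p M m a t + r))
       \<and> (\<forall>k. (\<forall>t\<in>{0 .. 1/2 - 1 / (2 * real p)} \<union> {1/2 + 1 / (2 * real p) .. 1}.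
                   Qmu p M m a t \<ge> Emu p M a k t) \<longrightarrow>
              (\<forall>s\<in>Iv p M m k. G p (mu p M m) \<le> G p s) \<and>
              (\<forall>s\<in>Iv p M m k. G p s = G p (mu p M m) \<longrightarrow> s = mu p M m))"
proof -
  have "p \<ge> 2" using assms(1) by (rule prime_ge_2_nat)
  moreover have "p \<noteq> 2" using assms(2) by auto
  ultimately have "p \<ge> 3" by linarith
  then interpret half_integer_point p M m a
    using assms by unfold_locales auto
  show ?thesis
    using G_theta_expansion G_mu_strict_minimum by (metis less_irrefl less_imp_le order_refl)
qed

end
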